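(* Let $\mathbf{X}$ be a $d$-dimensional random vector with mean $\boldsymbol{\mu}$ and positive definite covariance matrix $\boldsymbol{\Sigma}$. Let $K:\mathbb{R}^d\to[0,\infty)$ be the density of a spherical distribution symmetric about the origin, i.e. $K(\mathbf{t})=\Psi(\mathbf{t}^\top\mathbf{t})$ for some decreasing function $\Psi:[0,\infty)\to[0,\infty)$. For $h>0$ and $\mathbf{x}\in\mathbb{R}^d$ define $$\beta_h(\mathbf{x})=E\Big[K\Big(\frac{\boldsymbol{\Sigma}^{-1/2}(\mathbf{x}-\mathbf{X})}{h}\Big)(\mathbf{x}-\mathbf{X})^\top\boldsymbol{\Sigma}^{-1}(\mathbf{x}-\mathbf{X})\Big].$$ (a) If $K$ is continuous at $\mathbf{0}$, then for every $\mathbf{x}$, $\beta_h(\mathbf{x})\to K(\mathbf{0})\{(\mathbf{x}-\boldsymbol{\mu})^\top\boldsymbol{\Sigma}^{-1}(\mathbf{x}-\boldsymbol{\mu})+d\}$ as $h\to\infty$. (b) If $\mathbf{X}$ has a density $f$ whose gradient is bounded (i.e. $\sup_{\mathbf{x}}\|\nabla f(\mathbf{x})\|<\infty$) and $\int\|\mathbf{z}\|^3K(\mathbf{z})\,d\mathbf{z}<\infty$, then for every $\mathbf{x}$, $\beta_h(\mathbf{x})/h^{d+2}\to|\boldsymbol{\Sigma}|^{1/2}\kappa_2 f(\mathbf{x})$ as $h\to 0$, where $\kappa_2=\int\|\mathbf{z}\|^2K(\mathbf{z})\,d\mathbf{z}$.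
   Context: $|\boldsymbol{\Sigma}|$ denotes the determinant and $\boldsymbol{\Sigma}^{-1/2}$ the inverse of the symmetric positive definite square root of $\boldsymbol{\Sigma}$. *)

theory Defs
  imports "HOL-Probability.Probability"
begin

text \<open>Symmetric and positive definite real square matrices.\<close>
definition sym_mat :: "real^'n^'n \<Rightarrow> bool" where
  "sym_mat A \<longleftrightarrow> transpose A = A"

definition pos_def_mat :: "real^'n^'n \<Rightarrow> bool" where
  "pos_def_mat A \<longleftrightarrow> sym_mat A \<and> (\<forall>v. v \<noteq> 0 \<longrightarrow> v \<bullet> (A *v v) > 0)"

text \<open>Covariance matrix of a random vector X with mean mu.\<close>
definition cov_mat :: "'a measure \<Rightarrow> ('a \<Rightarrow> real^'n) \<Rightarrow> real^'n \<Rightarrow> real^'n^'n" where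
  "cov_mat M X mu = (\<chi> i j. integral\<^sup>L M (\<lambda>w. (X w $ i - mu $ i) * (X w $ j - mu $ j)))"

text \<open>beta_h(x) = E[ K(S (x - X)/h) (x-X)^T Sig^{-1} (x-X) ], S = Sig^{-1/2}.\<close>
definition beta :: "'a measure \<Rightarrow> ('a \<Rightarrow> real^'n) \<Rightarrow> (real^'n \<Rightarrow> real)
    \<Rightarrow> real^'n^'n \<Rightarrow> real^'n^'n \<Rightarrow> real \<Rightarrow> real^'n \<Rightarrow> real" where
  "beta M X K Sig S h x = integral\<^sup>L M (\<lambda>w.
      K ((1/h) *\<^sub>R (S *v (x - X w))) * ((x - X w) \<bullet> (matrix_inv Sig *v (x - X w))))"

end

theory Submission
  imports Defs
begin

(* (a) As h tends to infinity, K (S (x - X) / h) tends to K 0 pointwise and is dominated by K 0,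
   so beta_h(x) tends to K 0 * E[(x - X)' Sig^-1 (x - X)]; expanding around the mean, this
   expectation is (x - mu)' Sig^-1 (x - mu) + trace (Sig^-1 Sig).
   (b) Substituting y = x - h S^-1 z, where S^-1 is the square root of Sig, gives
   beta_h(x) = h^(d+2) |Sig|^(1/2) * Int |z|^2 K(z) f(x - h S^-1 z) dz.  A bounded gradient makes
   f Lipschitz, so the last integral differs from kappa_2 f(x) by O(h Int |z|^3 K(z) dz). *)

lemma
  fixes A :: "'a::semiring_1^'n^'m"
  assumes "invertible A"
  shows matrix_inv_right: "A ** matrix_inv A = mat 1"
    and matrix_inv_left: "matrix_inv A ** A = mat 1"
proof -
  have "A ** matrix_inv A = mat 1 \<and> matrix_inv A ** A = mat 1"
    using assms unfolding invertible_def matrix_inv_def by (rule someI_ex)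
  then show "A ** matrix_inv A = mat 1" "matrix_inv A ** A = mat 1"
    by auto
qed

lemma measure_coordinate_swap_cbox:
  fixes a b :: "real^'n"
  shows "measure lebesgue ((\<lambda>x. \<chi> i. x $ Transposition.transpose m n i) ` cbox a b)
    = measure lebesgue (cbox a b)"
proof -
  let ?p = "Transposition.transpose m n"
  let ?sw = "\<lambda>x::real^'n. \<chi> i. x $ ?p i"
  have pp: "?p (?p i) = i" for i
    by (rule transpose_involutory)
  have img: "?sw ` cbox a b = cbox (?sw a) (?sw b)"
  proof
    show "?sw ` cbox a b \<subseteq> cbox (?sw a) (?sw b)"
      by (auto simp: mem_box_cart)
    show "cbox (?sw a) (?sw b) \<subseteq> ?sw ` cbox a b"
    proof
      fix y assume y: "y \<in> cbox (?sw a) (?sw b)"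
      have "a $ i \<le> y $ ?p i \<and> y $ ?p i \<le> b $ i" for i
        using y pp[of i] unfolding mem_box_cart by (metis vec_lambda_beta)
      then have "?sw y \<in> cbox a b"
        by (simp add: mem_box_cart)
      moreover have "y = ?sw (?sw y)"
        by (simp add: vec_eq_iff pp)
      ultimately show "y \<in> ?sw ` cbox a b"
        by blast
    qed
  qed
  show ?thesis
  proof (cases "cbox a b = {}")
    case False
    have "(\<Prod>i\<in>UNIV. b $ ?p i - a $ ?p i) = (\<Prod>i\<in>UNIV. b $ i - a $ i)"
      using prod.permute[OF permutes_swap_id, where S=UNIV and g="\<lambda>i. b $ i - a $ i"]
      by (simp add: o_def)
    moreover have "cbox (?sw a) (?sw b) \<noteq> {}"
      using False img by blast
    ultimately show ?thesis
      using False unfolding img by (simp add: content_cbox_cart)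
  qed simp
qed

lemma measure_shear_cbox:
  fixes a b :: "real^'n"
  assumes "m \<noteq> n"
  shows "measure lebesgue ((\<lambda>x. \<chi> i. if i = m then x$m + x$n else x$i) ` cbox a b)
    = measure lebesgue (cbox a b)"
proof (cases "cbox a b = {}")
  case False
  let ?sh = "\<lambda>x::real^'n. \<chi> i. if i = m then x$m + x$n else x$i"
  \<comment> \<open>\<open>measure_shear_interval\<close> needs \<open>0 \<le> a$n\<close>, so first translate along axis \<open>n\<close>.\<close>
  define t where "t = axis n (a $ n)"
  have box_eq: "cbox a b = (+) t ` cbox (a - t) (b - t)"
    using cbox_translation[of t "a - t" "b - t"] by simp
  have "?sh ` cbox a b = (+) (?sh t) ` (?sh ` cbox (a - t) (b - t))"
    unfolding box_eq image_comp by (rule image_cong) (auto simp: vec_eq_iff)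
  then have "measure lebesgue (?sh ` cbox a b) = measure lebesgue (?sh ` cbox (a - t) (b - t))"
    by (simp add: measure_translation)
  also have "\<dots> = measure lebesgue (cbox (a - t) (b - t))"
    using assms False box_eq by (intro measure_shear_interval) (auto simp: t_def axis_def)
  also have "\<dots> = measure lebesgue (cbox a b)"
    using box_eq by (simp add: measure_translation)
  finally show ?thesis .
qed simp

lemma det_matrix_coordinate_swap:
  "\<bar>det (matrix (\<lambda>x::real^'n. \<chi> i. x $ Transposition.transpose m n i))\<bar> = 1"
proof -
  have "matrix (\<lambda>x::real^'n. \<chi> i. x $ Transposition.transpose m n i)
      = (\<chi> i. mat 1 $ Transposition.transpose m n i)"
    by (simp add: matrix_def axis_def mat_def vec_eq_iff)
  then show ?thesis
    by (simp add: det_permute_rows permutes_swap_id sign_swap_id)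
qed

lemma det_matrix_shear:
  assumes "m \<noteq> n"
  shows "det (matrix (\<lambda>x::real^'n. \<chi> i. if i = m then x$m + x$n else x$i)) = 1"
proof -
  have "matrix (\<lambda>x::real^'n. \<chi> i. if i = m then x$m + x$n else x$i)
      = (\<chi> k. if k = m then row m (mat 1) + 1 *s row n (mat 1) else row k (mat 1))"
    by (auto simp: matrix_def axis_def row_def mat_def vec_eq_iff)
  then show ?thesis
    using det_row_operation[OF assms, of "mat 1" 1] by simp
qed

lemma det_matrix_stretch: "det (matrix (\<lambda>x::real^'n. \<chi> k. c k * x$k)) = prod c UNIV"
  by (simp add: matrix_def axis_def det_diagonal)

lemma measure_linear_image_of_cbox:
  fixes f :: "real^'n \<Rightarrow> real^'n"
  assumes "linear f"
    and "\<And>a b. measure lebesgue (f ` cbox a b) = \<bar>det (matrix f)\<bar> * measure lebesgue (cbox a b)"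
  shows "\<forall>S \<in> lmeasurable. f ` S \<in> lmeasurable
    \<and> measure lebesgue (f ` S) = \<bar>det (matrix f)\<bar> * measure lebesgue S"
  using measure_linear_sufficient[OF assms(1) _ assms(2)] by auto

(* Change_Of_Vars.measure_linear_image assumes a well-ordered index type, which the induction
   over elementary linear maps does not need. *)
lemma measure_linear_image_cart:
  fixes f :: "real^'n \<Rightarrow> real^'n"
  assumes "linear f" and "S \<in> lmeasurable"
  shows "f ` S \<in> lmeasurable \<and> measure lebesgue (f ` S) = \<bar>det (matrix f)\<bar> * measure lebesgue S"
proof -
  let ?P = "\<lambda>f. \<forall>S \<in> lmeasurable. f ` S \<in> lmeasurable
    \<and> measure lebesgue (f ` S) = \<bar>det (matrix f)\<bar> * measure lebesgue S"
  have "?P f"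
  proof (rule induct_linear_elementary[OF assms(1)])
    fix f g :: "real^'n \<Rightarrow> real^'n"
    assume "linear f" "linear g" and f: "?P f" and g: "?P g"
    show "?P (f \<circ> g)"
    proof
      fix S :: "(real^'n) set"
      assume "S \<in> lmeasurable"
      then have "g ` S \<in> lmeasurable"
        using g by blast
      then show "(f \<circ> g) ` S \<in> lmeasurable \<and> measure lebesgue ((f \<circ> g) ` S)
          = \<bar>det (matrix (f \<circ> g))\<bar> * measure lebesgue S"
        using f g \<open>S \<in> lmeasurable\<close> matrix_compose[OF \<open>linear g\<close> \<open>linear f\<close>]
        unfolding image_comp[symmetric] by (simp add: det_mul abs_mult)
    qed
  next
    fix f :: "real^'n \<Rightarrow> real^'n" and i
    assume f: "linear f" "\<And>x. f x $ i = 0"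
    then have "\<not> surj f"
      by (metis one_neq_zero surjE vec_component)
    with f have "\<not> inj f"
      using linear_injective_imp_surjective by blast
    with f have "det (matrix f) = 0" "negligible (f ` S)" for S
      using det_nz_iff_inj[OF f(1)] negligible_linear_singular_image[OF f(1)] by auto
    then show "?P f"
      by (simp add: negligible_iff_measure)
  next
    fix c :: "'n \<Rightarrow> real"
    show "?P (\<lambda>x. \<chi> k. c k * x$k)"
      by (simp add: measurable_stretch measure_stretch det_matrix_stretch)
  next
    fix m n :: 'n
    have "linear (\<lambda>x::real^'n. \<chi> i. x $ Transposition.transpose m n i)"
      by (auto intro!: linearI simp: vec_eq_iff)
    then show "?P (\<lambda>x. \<chi> i. x $ Transposition.transpose m n i)"
      by (rule measure_linear_image_of_cbox)
        (simp add: measure_coordinate_swap_cbox det_matrix_coordinate_swap)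
  next
    fix m n :: 'n
    assume "m \<noteq> n"
    have "linear (\<lambda>x::real^'n. \<chi> i. if i = m then x$m + x$n else x$i)"
      by (auto intro!: linearI simp: vec_eq_iff algebra_simps)
    then show "?P (\<lambda>x. \<chi> i. if i = m then x$m + x$n else x$i)"
      by (rule measure_linear_image_of_cbox)
        (simp add: measure_shear_cbox det_matrix_shear \<open>m \<noteq> n\<close>)
  qed
  then show ?thesis
    using assms(2) by blast
qed

lemma borel_measurable_matrix_vector_mult [measurable]:
  "(*v) (A :: real^'n^'m) \<in> borel_measurable borel"
  by (intro borel_measurable_continuous_onI matrix_vector_mult_linear_continuous_on)

lemma vimage_affine_matrix_eq:
  fixes B :: "real^'n^'n"
  assumes "invertible B"
  shows "(\<lambda>z. t + B *v z) -` A = (*v) (matrix_inv B) ` ((+) (- t) ` A)"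
proof -
  have "t + B *v z \<in> A \<longleftrightarrow> z \<in> (*v) (matrix_inv B) ` ((+) (- t) ` A)" for z
  proof
    assume "t + B *v z \<in> A"
    moreover have "z = matrix_inv B *v (- t + (t + B *v z))"
      by (simp add: matrix_vector_mul_assoc matrix_inv_left[OF assms])
    ultimately show "z \<in> (*v) (matrix_inv B) ` ((+) (- t) ` A)"
      by blast
  qed (auto simp: matrix_vector_mul_assoc matrix_inv_right[OF assms])
  then show ?thesis
    by blast
qed

lemma lborel_eq_density_distr_affine_cart:
  fixes B :: "real^'n^'n" and t :: "real^'n"
  assumes "invertible B"
  shows "lborel = density (distr lborel borel (\<lambda>z. t + B *v z)) (\<lambda>_. ennreal \<bar>det B\<bar>)"
proof (rule lborel_eqI)
  fix l u :: "real^'n"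
  assume le: "\<And>b. b \<in> Basis \<Longrightarrow> l \<bullet> b \<le> u \<bullet> b"
  let ?A = "\<lambda>z. t + B *v z"
  let ?P = "?A -` box l u"
  have A_meas: "?A \<in> borel_measurable borel"
    by measurable
  have pre: "?P = (*v) (matrix_inv B) ` ((+) (- t) ` box l u)"
    by (rule vimage_affine_matrix_eq[OF assms])
  have box: "(+) (- t) ` box l u \<in> lmeasurable"
    by (rule measurable_translation) simp
  have P: "?P \<in> lmeasurable" "measure lebesgue ?P = \<bar>det (matrix_inv B)\<bar> * measure lebesgue (box l u)"
    using measure_linear_image_cart[OF matrix_vector_mul_linear box]
    unfolding pre measure_translation matrix_of_matrix_vector_mul by auto
  have "?P \<in> sets borel"
    using measurable_sets_borel[OF A_meas, of "box l u"] by simp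
  then have "emeasure lborel ?P = ennreal (\<bar>det (matrix_inv B)\<bar> * measure lebesgue (box l u))"
    using emeasure_eq_measure2[OF P(1)] P(2) by simp
  moreover have "\<bar>det B\<bar> * \<bar>det (matrix_inv B)\<bar> = 1"
    using det_mul[of B "matrix_inv B"] by (simp add: matrix_inv_right[OF assms] flip: abs_mult)
  ultimately show "emeasure (density (distr lborel borel ?A) (\<lambda>_. ennreal \<bar>det B\<bar>)) (box l u)
      = (\<Prod>b\<in>Basis. (u - l) \<bullet> b)"
    using le by (simp add: emeasure_density_const emeasure_distr measure_lborel_box_eq
        ennreal_mult'[symmetric] mult.assoc[symmetric] prod_nonneg)
qed simp

lemma integral_lborel_affine_cart:
  fixes B :: "real^'n^'n" and t :: "real^'n" and \<phi> :: "real^'n \<Rightarrow> real"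
  assumes "invertible B" and [measurable]: "\<phi> \<in> borel_measurable borel"
  shows "integral\<^sup>L lborel \<phi> = \<bar>det B\<bar> * (\<integral>z. \<phi> (t + B *v z) \<partial>lborel)"
  by (subst lborel_eq_density_distr_affine_cart[OF assms(1), of t])
    (simp add: integral_density integral_distr)

lemma det_scaleR_cart: "det (c *\<^sub>R (A :: real^'n^'n)) = c ^ CARD('n) * det A"
proof -
  have "c *\<^sub>R A = (\<chi> i. c *s A $ i)"
    by (simp add: vec_eq_iff)
  then show ?thesis
    by (simp add: det_rows_mul)
qed

lemma pos_def_mat_invertible:
  fixes A :: "real^'n^'n"
  assumes "pos_def_mat A"
  shows "invertible A"
proof -
  have "x = 0" if "A *v x = 0" for x
    using assms that unfolding pos_def_mat_def by (metis inner_zero_right less_irrefl)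
  then show ?thesis
    using matrix_left_invertible_ker invertible_left_inverse by blast
qed

lemma
  fixes S Sig :: "real^'n^'n"
  assumes "transpose S = S" "invertible S" "S ** S = matrix_inv Sig"
  shows matrix_inv_sqrt_vector: "S *v (matrix_inv S *v z) = z"
    and quadratic_form_matrix_inv_sqrt:
      "(matrix_inv S *v z) \<bullet> (matrix_inv Sig *v (matrix_inv S *v z)) = z \<bullet> z"
proof -
  show Sz: "S *v (matrix_inv S *v z) = z"
    by (simp add: matrix_vector_mul_assoc matrix_inv_right[OF assms(2)])
  have "matrix_inv Sig *v (matrix_inv S *v z) = S *v z"
    using Sz by (simp flip: assms(3) matrix_vector_mul_assoc)
  moreover have "(matrix_inv S *v z) \<bullet> (S *v z) = (S *v (matrix_inv S *v z)) \<bullet> z"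
    by (metis assms(1) dot_lmul_matrix transpose_matrix_vector)
  ultimately show "(matrix_inv S *v z) \<bullet> (matrix_inv Sig *v (matrix_inv S *v z)) = z \<bullet> z"
    by (simp add: Sz)
qed

lemma sqrt_det_eq_abs_det_matrix_inv_sqrt:
  fixes S Sig :: "real^'n^'n"
  assumes "invertible Sig" "invertible S" "S ** S = matrix_inv Sig"
  shows "sqrt (det Sig) = \<bar>det (matrix_inv S)\<bar>"
proof -
  have "det Sig * (det S * det S) = 1"
    using det_mul[of Sig "matrix_inv Sig"] det_mul[of S S]
    by (simp add: assms(3) matrix_inv_right[OF assms(1)])
  moreover have "det S * det (matrix_inv S) = 1"
    using det_mul[of S "matrix_inv S"] by (simp add: matrix_inv_right[OF assms(2)])
  ultimately have "det Sig = (det (matrix_inv S))\<^sup>2"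
    by algebra
  then show ?thesis
    by simp
qed

lemma
  fixes X :: "'a \<Rightarrow> real^'n"
  assumes "prob_space M" and X_sq: "integrable M (\<lambda>w. norm (X w) ^ 2)"
    and "integrable M X" "integral\<^sup>L M X = mu"
  shows integrable_product_components_about:
      "integrable M (\<lambda>w. (x - X w)$i * (x - X w)$j)"
    and integral_product_components_about:
      "(\<integral>w. (x - X w)$i * (x - X w)$j \<partial>M) = (x - mu)$i * (x - mu)$j + cov_mat M X mu $ i $ j"
proof -
  interpret prob_space M by fact
  have X: "integrable M (\<lambda>w. X w $ k)" "(\<integral>w. X w $ k \<partial>M) = mu $ k" for k
    using integrable_bounded_linear[OF bounded_linear_vec_nth \<open>integrable M X\<close>]
      integral_bounded_linear[OF bounded_linear_vec_nth \<open>integrable M X\<close>] assms(4)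
    by auto
  have XX: "integrable M (\<lambda>w. X w $ i * X w $ j)"
  proof (rule Bochner_Integration.integrable_bound[OF X_sq])
    show "(\<lambda>w. X w $ i * X w $ j) \<in> borel_measurable M"
      using X(1) by measurable
    have "\<bar>X w $ i\<bar> * \<bar>X w $ j\<bar> \<le> norm (X w) * norm (X w)" for w
      by (intro mult_mono component_le_norm_cart) auto
    then show "AE w in M. norm (X w $ i * X w $ j) \<le> norm (norm (X w) ^ 2)"
      by (simp add: abs_mult power2_eq_square)
  qed
  have expand: "(y - X w)$i * (y - X w)$j = y$i * y$j - y$i * X w $ j - y$j * X w $ i + X w $ i * X w $ j"
    for y w
    by (simp add: algebra_simps)
  show "integrable M (\<lambda>w. (x - X w)$i * (x - X w)$j)"
    unfolding expand using X XX by auto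
  have about: "(\<integral>w. (y - X w)$i * (y - X w)$j \<partial>M)
      = y$i * y$j - y$i * mu$j - y$j * mu$i + (\<integral>w. X w $ i * X w $ j \<partial>M)" for y
    unfolding expand using X XX by (simp add: prob_space)
  have "cov_mat M X mu $ i $ j = (\<integral>w. (mu - X w)$i * (mu - X w)$j \<partial>M)"
    unfolding cov_mat_def by (simp add: algebra_simps)
  also have "\<dots> = (\<integral>w. X w $ i * X w $ j \<partial>M) - mu$i * mu$j"
    unfolding about by (simp add: algebra_simps)
  finally show "(\<integral>w. (x - X w)$i * (x - X w)$j \<partial>M) = (x - mu)$i * (x - mu)$j + cov_mat M X mu $ i $ j"
    unfolding about by (simp add: algebra_simps)
qed

lemma quadratic_form_eq_sum: "v \<bullet> (A *v v) = (\<Sum>i\<in>UNIV. \<Sum>j\<in>UNIV. A$i$j * (v$i * v$j))"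
  for A :: "real^'n^'n"
  by (simp add: inner_vec_def matrix_vector_mult_def sum_distrib_left algebra_simps)

lemma
  fixes X :: "'a \<Rightarrow> real^'n" and A :: "real^'n^'n"
  assumes "prob_space M" "integrable M (\<lambda>w. norm (X w) ^ 2)" "integrable M X" "integral\<^sup>L M X = mu"
  shows integrable_quadratic_form_about:
      "integrable M (\<lambda>w. (x - X w) \<bullet> (A *v (x - X w)))"
    and integral_quadratic_form_about:
      "(\<integral>w. (x - X w) \<bullet> (A *v (x - X w)) \<partial>M)
        = (x - mu) \<bullet> (A *v (x - mu)) + trace (A ** transpose (cov_mat M X mu))"
proof -
  note moments = integrable_product_components_about[OF assms] integral_product_components_about[OF assms]
  show "integrable M (\<lambda>w. (x - X w) \<bullet> (A *v (x - X w)))"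
    unfolding quadratic_form_eq_sum using moments by auto
  have "trace (A ** transpose (cov_mat M X mu)) = (\<Sum>i\<in>UNIV. \<Sum>j\<in>UNIV. A$i$j * cov_mat M X mu $ i $ j)"
    by (simp add: trace_def matrix_matrix_mult_def transpose_def)
  then show "(\<integral>w. (x - X w) \<bullet> (A *v (x - X w)) \<partial>M)
      = (x - mu) \<bullet> (A *v (x - mu)) + trace (A ** transpose (cov_mat M X mu))"
    unfolding quadratic_form_eq_sum using moments
    by (simp add: integral_sum integrable_sum distrib_left sum.distrib)
qed

lemma tendsto_integral_rescaled_kernel_at_top:
  fixes K :: "'b::euclidean_space \<Rightarrow> real" and u :: "'a \<Rightarrow> 'b"
  assumes "isCont K 0" "K \<in> borel_measurable borel" "\<And>t. \<bar>K t\<bar> \<le> c"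
    and "u \<in> borel_measurable M" "integrable M g"
  shows "((\<lambda>h. \<integral>w. K ((1/h) *\<^sub>R u w) * g w \<partial>M) \<longlongrightarrow> K 0 * integral\<^sup>L M g) at_top"
proof (rule tendsto_at_topI_sequentially)
  fix H :: "nat \<Rightarrow> real"
  assume H: "filterlim H at_top sequentially"
  have "(\<lambda>n. \<integral>w. K ((1 / H n) *\<^sub>R u w) * g w \<partial>M) \<longlonglongrightarrow> \<integral>w. K 0 * g w \<partial>M"
  proof (rule integral_dominated_convergence[where w="\<lambda>w. c * \<bar>g w\<bar>"])
    show "AE w in M. (\<lambda>n. K ((1 / H n) *\<^sub>R u w) * g w) \<longlonglongrightarrow> K 0 * g w"
    proof (rule AE_I2)
      fix w
      have "(\<lambda>n. (1 / H n) *\<^sub>R u w) \<longlonglongrightarrow> 0 *\<^sub>R u w"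
        using tendsto_inverse_0_at_top[OF H] by (intro tendsto_scaleR) (auto simp: divide_inverse)
      then have "(\<lambda>n. K ((1 / H n) *\<^sub>R u w)) \<longlonglongrightarrow> K 0"
        by (intro isCont_tendsto_compose[OF assms(1)]) simp
      then show "(\<lambda>n. K ((1 / H n) *\<^sub>R u w) * g w) \<longlonglongrightarrow> K 0 * g w"
        by (rule tendsto_mult_right)
    qed
    show "AE w in M. norm (K ((1 / H n) *\<^sub>R u w) * g w) \<le> c * \<bar>g w\<bar>" for n
      using assms(3) by (intro AE_I2) (simp add: abs_mult mult_right_mono)
  qed (use assms(2,4,5) in \<open>auto\<close>)
  then show "(\<lambda>n. \<integral>w. K ((1 / H n) *\<^sub>R u w) * g w \<partial>M) \<longlonglongrightarrow> K 0 * integral\<^sup>L M g"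
    by simp
qed

lemma lipschitz_on_bounded_gradient:
  fixes f :: "'a::real_inner \<Rightarrow> real"
  assumes "\<And>x. (f has_derivative (\<lambda>v. g x \<bullet> v)) (at x)" and "\<And>x. norm (g x) \<le> L"
  shows "L-lipschitz_on UNIV f"
proof (rule bounded_derivative_imp_lipschitz)
  show "0 \<le> L"
    using assms(2) norm_ge_zero order_trans by blast
  show "onorm (\<lambda>v. g x \<bullet> v) \<le> L" for x
  proof (rule onorm_bound[OF \<open>0 \<le> L\<close>])
    show "norm (g x \<bullet> v) \<le> L * norm v" for v
      using Cauchy_Schwarz_ineq2[of "g x" v] assms(2)[of x] by (simp add: mult_right_mono order_trans)
  qed
qed (use assms(1) in auto)

lemma integrable_norm_power2_mult:
  fixes K :: "'a::euclidean_space \<Rightarrow> real"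
  assumes "\<And>z. 0 \<le> K z" "integrable lborel K" "integrable lborel (\<lambda>z. norm z ^ 3 * K z)"
  shows "integrable lborel (\<lambda>z. norm z ^ 2 * K z)"
proof (rule Bochner_Integration.integrable_bound[where f="\<lambda>z. K z + norm z ^ 3 * K z"])
  show "integrable lborel (\<lambda>z. K z + norm z ^ 3 * K z)"
    using assms by auto
  show "(\<lambda>z. norm z ^ 2 * K z) \<in> borel_measurable lborel"
    using assms(2)[THEN borel_measurable_integrable] by measurable
  have "norm z ^ 2 \<le> 1 + norm z ^ 3" for z :: 'a
    by (cases "norm z \<le> 1")
      (auto intro: order_trans[OF power_le_one] power_increasing order_trans[OF _ le_add_same_cancel2[THEN iffD2]])
  then have "norm z ^ 2 * K z \<le> (1 + norm z ^ 3) * K z" for z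
    using assms(1) by (intro mult_right_mono)
  then show "AE z in lborel. norm (norm z ^ 2 * K z) \<le> norm (K z + norm z ^ 3 * K z)"
    using assms(1) by (intro AE_I2) (simp add: algebra_simps)
qed

lemma
  fixes w :: "'a::euclidean_space \<Rightarrow> real" and f :: "'b::euclidean_space \<Rightarrow> real" and T :: "'a \<Rightarrow> 'b"
  assumes w_nonneg: "\<And>z. 0 \<le> w z" and w_int: "integrable lborel w"
    and w1_int: "integrable lborel (\<lambda>z. norm z * w z)"
    and T: "bounded_linear T" and lip: "L-lipschitz_on UNIV f"
  shows integrable_lipschitz_rescaled:
      "integrable lborel (\<lambda>z. w z * f (x - h *\<^sub>R T z))"
    and integral_lipschitz_rescaled_error:
      "norm ((\<integral>z. w z * f (x - h *\<^sub>R T z) \<partial>lborel) - integral\<^sup>L lborel w * f x)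
        \<le> \<bar>h\<bar> * (L * onorm T * (\<integral>z. norm z * w z \<partial>lborel))"
proof -
  let ?err = "\<lambda>z. w z * (f (x - h *\<^sub>R T z) - f x)"
  have err_bound: "\<bar>?err z\<bar> \<le> \<bar>h\<bar> * (L * onorm T) * (norm z * w z)" for z
  proof -
    have "\<bar>?err z\<bar> = w z * \<bar>f (x - h *\<^sub>R T z) - f x\<bar>"
      using w_nonneg by (simp add: abs_mult)
    also have "\<dots> \<le> w z * (L * norm (h *\<^sub>R T z))"
      using lipschitz_on_normD[OF lip, of "x - h *\<^sub>R T z" x] w_nonneg by (intro mult_left_mono) auto
    also have "\<dots> \<le> w z * (L * (\<bar>h\<bar> * (onorm T * norm z)))"
    proof -
      have "norm (h *\<^sub>R T z) \<le> \<bar>h\<bar> * (onorm T * norm z)"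
        using onorm[OF T, of z] by (simp add: mult_left_mono)
      then show ?thesis
        using lipschitz_on_nonneg[OF lip] w_nonneg by (simp add: mult_left_mono)
    qed
    finally show ?thesis
      by (simp add: ac_simps)
  qed
  have "continuous_on UNIV (\<lambda>z. f (x - h *\<^sub>R T z))"
    by (intro continuous_on_compose2[OF lipschitz_on_continuous_on[OF lip]] continuous_intros
        linear_continuous_on T) auto
  then have "(\<lambda>z. f (x - h *\<^sub>R T z)) \<in> borel_measurable lborel"
    by (simp add: borel_measurable_continuous_onI)
  have err_int: "integrable lborel ?err"
  proof (rule Bochner_Integration.integrable_bound)
    show "integrable lborel (\<lambda>z. \<bar>h\<bar> * (L * onorm T) * (norm z * w z))"
      using w1_int by simp
    show "?err \<in> borel_measurable lborel"
      using \<open>(\<lambda>z. f (x - h *\<^sub>R T z)) \<in> borel_measurable lborel\<close> w_int[THEN borel_measurable_integrable]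
      by measurable
    show "AE z in lborel. norm (?err z) \<le> norm (\<bar>h\<bar> * (L * onorm T) * (norm z * w z))"
      using order_trans[OF err_bound abs_ge_self] by (intro AE_I2) simp
  qed
  show int: "integrable lborel (\<lambda>z. w z * f (x - h *\<^sub>R T z))"
    using Bochner_Integration.integrable_add[OF err_int integrable_mult_left[OF w_int, of "f x"]]
    by (simp add: algebra_simps)
  have "(\<integral>z. w z * f (x - h *\<^sub>R T z) \<partial>lborel) - integral\<^sup>L lborel w * f x = integral\<^sup>L lborel ?err"
    using int w_int by (simp add: right_diff_distrib)
  also have "norm \<dots> \<le> (\<integral>z. \<bar>h\<bar> * (L * onorm T) * (norm z * w z) \<partial>lborel)"
    using err_int w1_int err_bound by (intro Bochner_Integration.integral_norm_bound_integral) auto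
  finally show "norm ((\<integral>z. w z * f (x - h *\<^sub>R T z) \<partial>lborel) - integral\<^sup>L lborel w * f x)
      \<le> \<bar>h\<bar> * (L * onorm T * (\<integral>z. norm z * w z \<partial>lborel))"
    by (simp add: ac_simps)
qed

lemma tendsto_integral_lipschitz_rescaled_at_right_0:
  fixes w :: "'a::euclidean_space \<Rightarrow> real" and f :: "'b::euclidean_space \<Rightarrow> real" and T :: "'a \<Rightarrow> 'b"
  assumes "\<And>z. 0 \<le> w z" "integrable lborel w" "integrable lborel (\<lambda>z. norm z * w z)"
    and "bounded_linear T" "L-lipschitz_on UNIV f"
  shows "((\<lambda>h. \<integral>z. w z * f (x - h *\<^sub>R T z) \<partial>lborel) \<longlongrightarrow> integral\<^sup>L lborel w * f x) (at_right 0)"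
proof -
  let ?c = "L * onorm T * (\<integral>z. norm z * w z \<partial>lborel)"
  have "((\<lambda>h. (\<integral>z. w z * f (x - h *\<^sub>R T z) \<partial>lborel) - integral\<^sup>L lborel w * f x) \<longlongrightarrow> 0) (at_right 0)"
  proof (rule Lim_null_comparison)
    show "\<forall>\<^sub>F h in at_right 0.
        norm ((\<integral>z. w z * f (x - h *\<^sub>R T z) \<partial>lborel) - integral\<^sup>L lborel w * f x) \<le> \<bar>h\<bar> * ?c"
      by (intro always_eventually allI) (rule integral_lipschitz_rescaled_error[OF assms])
    show "((\<lambda>h. \<bar>h\<bar> * ?c) \<longlongrightarrow> 0) (at_right 0)"
      by (intro tendsto_mult_left_zero tendsto_rabs_zero tendsto_ident_at)
  qed
  then show ?thesis
    by (simp add: LIM_zero_iff)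
qed

lemma beta_eq_rescaled_integral:
  fixes X :: "'a \<Rightarrow> real^'n" and f :: "real^'n \<Rightarrow> real" and S Sig :: "real^'n^'n"
  assumes X_meas: "X \<in> borel_measurable M"
    and density: "distr M lborel X = density lborel (\<lambda>y. ennreal (f y))"
    and f_nonneg: "\<And>y. 0 \<le> f y" and f_meas: "f \<in> borel_measurable borel"
    and S: "transpose S = S" "invertible S" "S ** S = matrix_inv Sig"
    and K_meas: "K \<in> borel_measurable borel" and "0 < h"
  shows "beta M X K Sig S h x = h ^ (CARD('n) + 2) * \<bar>det (matrix_inv S)\<bar>
    * (\<integral>z. norm z ^ 2 * K z * f (x - h *\<^sub>R (matrix_inv S *v z)) \<partial>lborel)"
proof -
  define T where "T = matrix_inv S"
  define \<phi> where "\<phi> y = K ((1/h) *\<^sub>R (S *v (x - y))) * ((x - y) \<bullet> (matrix_inv Sig *v (x - y)))" for y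
  have [measurable]: "\<phi> \<in> borel_measurable borel"
    unfolding \<phi>_def using K_meas by measurable
  have "invertible T"
    using matrix_inv_left[OF S(2)] matrix_inv_right[OF S(2)] unfolding T_def invertible_def by blast
  define B where "B = (- h) *\<^sub>R T"
  have B: "invertible B"
    using \<open>0 < h\<close> \<open>invertible T\<close> unfolding B_def by (intro scalar_invertible) auto
  have det_B: "\<bar>det B\<bar> = h ^ CARD('n) * \<bar>det T\<bar>"
    using \<open>0 < h\<close> det_scaleR_cart[of "- h" T] by (simp add: B_def abs_mult power_abs)
  have Bz: "x + B *v z = x - h *\<^sub>R (T *v z)" for z
    using scaleR_matrix_vector_assoc[of "- h" T z] by (simp add: B_def)
  have \<phi>_rescaled: "\<phi> (x - h *\<^sub>R (T *v z)) = h\<^sup>2 * (norm z ^ 2 * K z)" for z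
    using \<open>0 < h\<close> matrix_inv_sqrt_vector[OF S, of z] quadratic_form_matrix_inv_sqrt[OF S, of z]
    by (simp add: \<phi>_def T_def matrix_vector_mult_scaleR power2_eq_square flip: power2_norm_eq_inner)
  have "beta M X K Sig S h x = (\<integral>w. \<phi> (X w) \<partial>M)"
    unfolding beta_def \<phi>_def ..
  also have "\<dots> = integral\<^sup>L (distr M lborel X) \<phi>"
    using X_meas by (intro integral_distr[symmetric]) auto
  also have "\<dots> = (\<integral>y. f y * \<phi> y \<partial>lborel)"
    unfolding density using f_nonneg f_meas by (subst integral_density) auto
  also have "\<dots> = \<bar>det B\<bar> * (\<integral>z. f (x + B *v z) * \<phi> (x + B *v z) \<partial>lborel)"
    using f_meas by (intro integral_lborel_affine_cart B) auto
  also have "(\<lambda>z. f (x + B *v z) * \<phi> (x + B *v z))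
      = (\<lambda>z. h\<^sup>2 * (norm z ^ 2 * K z * f (x - h *\<^sub>R (T *v z))))"
    by (simp add: Bz \<phi>_rescaled fun_eq_iff ac_simps)
  finally show ?thesis
    unfolding integral_mult_right_zero det_B T_def by (simp add: power_add power2_eq_square ac_simps)
qed

lemma transpose_cov_mat: "transpose (cov_mat M X mu) = cov_mat M X mu"
  by (simp add: cov_mat_def transpose_def vec_eq_iff mult.commute)

lemma tendsto_beta_at_top:
  fixes X :: "'a \<Rightarrow> real^'n" and Sig S :: "real^'n^'n"
  assumes moments: "prob_space M" "integrable M (\<lambda>w. norm (X w) ^ 2)" "integrable M X" "integral\<^sup>L M X = mu"
    and Sig: "cov_mat M X mu = Sig" "invertible Sig"
    and K: "isCont K 0" "K \<in> borel_measurable borel" "\<And>t. \<bar>K t\<bar> \<le> K 0"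
  shows "((\<lambda>h. beta M X K Sig S h x)
    \<longlongrightarrow> K 0 * ((x - mu) \<bullet> (matrix_inv Sig *v (x - mu)) + real CARD('n))) at_top"
proof -
  have "(\<lambda>w. S *v (x - X w)) \<in> borel_measurable M"
    using borel_measurable_integrable[OF moments(3)] by measurable
  then have "((\<lambda>h. beta M X K Sig S h x)
      \<longlongrightarrow> K 0 * (\<integral>w. (x - X w) \<bullet> (matrix_inv Sig *v (x - X w)) \<partial>M)) at_top"
    unfolding beta_def
    by (intro tendsto_integral_rescaled_kernel_at_top[OF K] integrable_quadratic_form_about[OF moments])
  moreover have "trace (matrix_inv Sig ** transpose Sig) = real CARD('n)"
    by (simp add: transpose_cov_mat flip: Sig(1)) (simp add: Sig matrix_inv_left trace_I)
  ultimately show ?thesis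
    by (simp add: integral_quadratic_form_about[OF moments] Sig(1))
qed

lemma tendsto_beta_at_right_0:
  fixes X :: "'a \<Rightarrow> real^'n" and f :: "real^'n \<Rightarrow> real" and S Sig :: "real^'n^'n"
  assumes X_meas: "X \<in> borel_measurable M"
    and density: "distr M lborel X = density lborel (\<lambda>y. ennreal (f y))"
    and f_nonneg: "\<And>y. 0 \<le> f y" and lip: "L-lipschitz_on UNIV f"
    and Sig: "invertible Sig" and S: "transpose S = S" "invertible S" "S ** S = matrix_inv Sig"
    and K_nonneg: "\<And>z. 0 \<le> K z" and K_meas: "K \<in> borel_measurable borel"
    and K_int: "integrable lborel K" and K3: "integrable lborel (\<lambda>z. norm z ^ 3 * K z)"
  shows "((\<lambda>h. beta M X K Sig S h x / h ^ (CARD('n) + 2))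
    \<longlongrightarrow> sqrt (det Sig) * integral\<^sup>L lborel (\<lambda>z. norm z ^ 2 * K z) * f x) (at_right 0)"
proof -
  let ?G = "\<lambda>h. \<integral>z. norm z ^ 2 * K z * f (x - h *\<^sub>R (matrix_inv S *v z)) \<partial>lborel"
  have f_meas: "f \<in> borel_measurable borel"
    using lip by (intro borel_measurable_continuous_onI lipschitz_on_continuous_on)
  have "(?G \<longlongrightarrow> integral\<^sup>L lborel (\<lambda>z. norm z ^ 2 * K z) * f x) (at_right 0)"
    using K3 by (intro tendsto_integral_lipschitz_rescaled_at_right_0[OF _ _ _ _ lip]
        integrable_norm_power2_mult[OF K_nonneg K_int K3] matrix_vector_mul_bounded_linear)
      (simp_all add: K_nonneg power3_eq_cube power2_eq_square ac_simps)
  then have "((\<lambda>h. \<bar>det (matrix_inv S)\<bar> * ?G h)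
      \<longlongrightarrow> sqrt (det Sig) * integral\<^sup>L lborel (\<lambda>z. norm z ^ 2 * K z) * f x) (at_right 0)"
    unfolding mult.assoc sqrt_det_eq_abs_det_matrix_inv_sqrt[OF Sig S(2,3)] by (rule tendsto_mult_left)
  moreover have "\<forall>\<^sub>F h in at_right 0. \<bar>det (matrix_inv S)\<bar> * ?G h = beta M X K Sig S h x / h ^ (CARD('n) + 2)"
    using eventually_at_right_less[of "0::real"]
    by eventually_elim (simp add: beta_eq_rescaled_integral[OF X_meas density f_nonneg f_meas S K_meas])
  ultimately show ?thesis
    by (rule Lim_transform_eventually)
qed

theorem lemma2:
  fixes M :: "'a measure" and X :: "'a \<Rightarrow> real^'n" and mu :: "real^'n"
    and Sig S :: "real^'n^'n" and K :: "real^'n \<Rightarrow> real" and Psi :: "real \<Rightarrow> real"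
  assumes prob: "prob_space M"
    and X_meas: "X \<in> borel_measurable M"
    and X_sq: "integrable M (\<lambda>w. norm (X w) ^ 2)"
    and mean: "integrable M X" "integral\<^sup>L M X = mu"
    and cov: "cov_mat M X mu = Sig"
    and Sig_pd: "pos_def_mat Sig"
    and S_sqrt: "pos_def_mat S" "S ** S = matrix_inv Sig"
    and K_Psi: "\<And>t. K t = Psi (t \<bullet> t)"
    and Psi_nonneg: "\<And>s. 0 \<le> s \<Longrightarrow> 0 \<le> Psi s"
    and Psi_decr: "\<And>a b. 0 \<le> a \<Longrightarrow> a \<le> b \<Longrightarrow> Psi b \<le> Psi a"
    and K_meas: "K \<in> borel_measurable lborel"
    and K_dens: "integrable lborel K" "integral\<^sup>L lborel K = 1"
  shows
    "(isCont K 0 \<longrightarrow>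
        (\<forall>x. ((\<lambda>h. beta M X K Sig S h x) \<longlongrightarrow>
              K 0 * ((x - mu) \<bullet> (matrix_inv Sig *v (x - mu)) + real CARD('n))) at_top))
     \<and>
     (\<forall>f g. (\<forall>x. 0 \<le> f x)
        \<and> distr M lborel X = density lborel (\<lambda>x. ennreal (f x))
        \<and> (\<forall>x. (f has_derivative (\<lambda>v. g x \<bullet> v)) (at x))
        \<and> bounded (range g)
        \<and> integrable lborel (\<lambda>z. norm z ^ 3 * K z)
        \<longrightarrow>
        (\<forall>x. ((\<lambda>h. beta M X K Sig S h x / h ^ (CARD('n) + 2)) \<longlongrightarrow>
              sqrt (det Sig) * integral\<^sup>L lborel (\<lambda>z. norm z ^ 2 * K z) * f x) (at_right 0)))"
proof (intro conjI impI allI)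
  have K_meas': "K \<in> borel_measurable borel"
    using K_meas by simp
  have Sig_inv: "invertible Sig"
    by (rule pos_def_mat_invertible[OF Sig_pd])
  have K_bound: "\<bar>K t\<bar> \<le> K 0" for t
    by (simp add: K_Psi Psi_nonneg Psi_decr)
  fix x
  show "((\<lambda>h. beta M X K Sig S h x) \<longlongrightarrow>
      K 0 * ((x - mu) \<bullet> (matrix_inv Sig *v (x - mu)) + real CARD('n))) at_top" if "isCont K 0"
    using tendsto_beta_at_top[OF prob X_sq mean cov Sig_inv that K_meas' K_bound] .
  fix f g
  assume "(\<forall>x. 0 \<le> f x)
        \<and> distr M lborel X = density lborel (\<lambda>x. ennreal (f x))
        \<and> (\<forall>x. (f has_derivative (\<lambda>v. g x \<bullet> v)) (at x))
        \<and> bounded (range g)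
        \<and> integrable lborel (\<lambda>z. norm z ^ 3 * K z)"
  moreover from this obtain L where "\<And>y. norm (g y) \<le> L"
    unfolding bounded_iff by auto
  ultimately show "((\<lambda>h. beta M X K Sig S h x / h ^ (CARD('n) + 2)) \<longlongrightarrow>
      sqrt (det Sig) * integral\<^sup>L lborel (\<lambda>z. norm z ^ 2 * K z) * f x) (at_right 0)"
    using S_sqrt pos_def_mat_invertible[OF S_sqrt(1)]
    by (intro tendsto_beta_at_right_0[OF X_meas _ _ lipschitz_on_bounded_gradient Sig_inv _ _ _ _ K_meas' K_dens(1)])
      (auto simp: pos_def_mat_def sym_mat_def K_Psi Psi_nonneg)
qed

end
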